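(* For all integers $n \ge 4$ and $p$ with $2 \le p \le n/2$, there exists a symmetric matrix $A \in \mathbb{R}^{n\times n}$ such that the optimization problem $$\min_{Y \in \mathcal{M}_{n,p}} \langle A, YY^\top\rangle$$ has a spurious local minimum.
   Context: $\mathcal{M}_{n,p} := \{Y \in \mathbb{R}^{n\times p} : \|Y_i\|^2 = 1 \text{ for all } i \in [n]\}$, where $Y_i \in \mathbb{R}^p$ is the $i$th row of $Y$, $\|\cdot\|$ is the Euclidean (Frobenius) norm, and $\langle\cdot,\cdot\rangle$ is the trace (Frobenius) inner product. A point $Y \in \mathcal{M}_{n,p}$ is a local minimum if there is $\epsilon>0$ such that $\langle A, YY^\top\rangle \le \langle A, ZZ^\top\rangle$ for all $Z \in \mathcal{M}_{n,p}$ with $\|Z-Y\|<\epsilon$; it is a global minimum if this inequality holds for all $Z \in \mathcal{M}_{n,p}$. A local minimum is spurious if it is not a global minimum. *)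

theory Defs
  imports "HOL-Analysis.Analysis"
begin

text \<open>
  Matrices with \<open>n\<close> rows and \<open>p\<close> columns are elements of \<^typ>\<open>real^'p^'n\<close>, where
  \<open>CARD('n) = n\<close> and \<open>CARD('p) = p\<close>; \<open>Y $ i\<close> is the \<open>i\<close>th row of \<open>Y\<close>.  The inner product
  and norm that the library puts on this type are the trace inner product and the Frobenius norm:
\<close>

lemma inner_matrix_eq_trace:
  fixes A B :: "real^'p^'n"
  shows "A \<bullet> B = trace (transpose A ** B)"
  unfolding inner_vec_def trace_def transpose_def matrix_matrix_mult_def
  by (simp, rule sum.swap)

lemma norm_matrix_eq_Frobenius:
  fixes Y :: "real^'p^'n"
  shows "norm Y = sqrt (\<Sum>i\<in>UNIV. \<Sum>j\<in>UNIV. (Y $ i $ j)\<^sup>2)"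
  by (simp add: norm_eq_sqrt_inner inner_vec_def power2_eq_square)

definition unit_row_matrices :: "(real^'p^'n) set" where
  "unit_row_matrices = {Y. \<forall>i. (norm (Y $ i))\<^sup>2 = 1}"

definition objective :: "real^'n^'n \<Rightarrow> real^'p^'n \<Rightarrow> real" where
  "objective A Y = A \<bullet> (Y ** transpose Y)"

definition local_minimum :: "real^'n^'n \<Rightarrow> real^'p^'n \<Rightarrow> bool" where
  "local_minimum A Y \<longleftrightarrow> Y \<in> unit_row_matrices \<and>
     (\<exists>\<epsilon>>0. \<forall>Z\<in>(unit_row_matrices :: (real^'p^'n) set). norm (Z - Y) < \<epsilon> \<longrightarrow> objective A Y \<le> objective A Z)"

definition global_minimum :: "real^'n^'n \<Rightarrow> real^'p^'n \<Rightarrow> bool" where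
  "global_minimum A Y \<longleftrightarrow> Y \<in> unit_row_matrices \<and>
     (\<forall>Z\<in>(unit_row_matrices :: (real^'p^'n) set). objective A Y \<le> objective A Z)"

definition spurious_local_minimum :: "real^'n^'n \<Rightarrow> real^'p^'n \<Rightarrow> bool" where
  "spurious_local_minimum A Y \<longleftrightarrow> local_minimum A Y \<and> \<not> global_minimum A Y"

end

(*
  Pair up 2p of the rows and let w k be the sum of the k-th pair.  The quadratic form
  sum_k |w k|^2 - |sum_k w k|^2 / (p - 1/2) is negative when all w k are equal and nonzero.
  It vanishes at the point Y whose k-th pair is e_k, -e_k, where all w k are zero.  Near Y the
  vector w k is almost orthogonal to e_k, because u + v is orthogonal to u - v for unit
  vectors u, v.  So the j-th coordinates of the w k have at most p - 1 non-negligible entries,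
  and by Cauchy-Schwarz the form is nonnegative there.
*)
theory Submission
  imports Defs
begin

definition outer_square :: "real^'n \<Rightarrow> real^'n^'n" where
  "outer_square g = (\<chi> i j. g $ i * g $ j)"

lemma objective_eq_sum:
  "objective A Y = (\<Sum>i\<in>UNIV. \<Sum>j\<in>UNIV. A $ i $ j * (Y $ i \<bullet> Y $ j))"
  by (simp add: objective_def inner_vec_def matrix_matrix_mult_def transpose_def)

text \<open>Expanding the square gives the coefficients \<open>g $ i * g $ j\<close> of the rank-one
  matrix. Through this identity a matrix can be designed as a combination of squared norms of sums
  of rows.\<close>

lemma objective_outer_square:
  "objective (outer_square g) Y = (norm (\<Sum>i\<in>UNIV. g $ i *\<^sub>R Y $ i))\<^sup>2"
  by (simp add: objective_eq_sum outer_square_def power2_norm_eq_inner inner_sum_left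
      inner_sum_right mult.assoc)
     (subst sum.swap, simp add: sum_distrib_left inner_commute mult.left_commute)

lemma weighted_sum_power2_le:
  fixes x :: "'p::finite \<Rightarrow> real"
  shows "(\<Sum>k\<in>UNIV. x k)\<^sup>2 \<le> (real CARD('p) - 3/4) * ((\<Sum>k\<in>UNIV. (x k)\<^sup>2) + 3 * (x j)\<^sup>2)"
proof -
  \<comment> \<open>Weight 1/2 at \<open>j\<close> lowers the sum of squared weights from p to p -
    3/4; the price is that the \<open>j\<close>-th square counts four times, which is harmless when
    \<open>x j\<close> is small.\<close>
  define d :: "'p \<Rightarrow> real" where "d k = (if k = j then 1/2 else 1)" for k
  have "(\<Sum>k\<in>UNIV. x k)\<^sup>2 = (\<Sum>k\<in>UNIV. d k * (x k / d k))\<^sup>2"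
    by (simp add: d_def)
  also have "\<dots> \<le> (\<Sum>k\<in>UNIV. (d k)\<^sup>2) * (\<Sum>k\<in>UNIV. (x k / d k)\<^sup>2)"
    by (rule Cauchy_Schwarz_ineq_sum)
  also have "(\<Sum>k\<in>UNIV. (d k)\<^sup>2) = (\<Sum>k\<in>UNIV. 1 - (if k = j then 3/4 else 0))"
    by (rule sum.cong) (auto simp: d_def power2_eq_square)
  also have "\<dots> = real CARD('p) - 3/4"
    by (simp add: sum_subtractf)
  also have "(\<Sum>k\<in>UNIV. (x k / d k)\<^sup>2) = (\<Sum>k\<in>UNIV. (x k)\<^sup>2 + (if k = j then 3 * (x j)\<^sup>2 else 0))"
    by (rule sum.cong) (auto simp: d_def power2_eq_square)
  also have "\<dots> = (\<Sum>k\<in>UNIV. (x k)\<^sup>2) + 3 * (x j)\<^sup>2"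
    by (simp add: sum.distrib)
  finally show ?thesis .
qed

text \<open>The weighted inequality is applied to each coordinate \<open>j\<close> with
  \<open>j\<close> itself as the distinguished index. The extra terms are then the diagonal entries
  \<open>w j $ j\<close>, which the hypothesis bounds.\<close>

lemma norm_sum_power2_le:
  fixes w :: "'p::finite \<Rightarrow> real^'p"
  assumes "\<And>k. \<bar>w k $ k\<bar> \<le> \<delta> * norm (w k)"
  shows "(norm (\<Sum>k\<in>UNIV. w k))\<^sup>2
    \<le> (real CARD('p) - 3/4) * (1 + 3 * \<delta>\<^sup>2) * (\<Sum>k\<in>UNIV. (norm (w k))\<^sup>2)"
proof -
  have norm2: "(norm v)\<^sup>2 = (\<Sum>j\<in>UNIV. (v $ j)\<^sup>2)" for v :: "real^'p"
    by (simp add: norm_vec_def L2_set_def sum_nonneg)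
  have card: "real CARD('p) \<ge> 1"
    by (simp add: Suc_leI)
  have diag: "(w k $ k)\<^sup>2 \<le> \<delta>\<^sup>2 * (norm (w k))\<^sup>2" for k
    using power_mono[OF assms[of k] abs_ge_zero, of 2] by (simp add: power_mult_distrib)
  have "(norm (\<Sum>k\<in>UNIV. w k))\<^sup>2 = (\<Sum>j\<in>UNIV. (\<Sum>k\<in>UNIV. w k $ j)\<^sup>2)"
    by (simp add: norm2)
  also have "\<dots> \<le> (\<Sum>j\<in>UNIV. (real CARD('p) - 3/4)
      * ((\<Sum>k\<in>UNIV. (w k $ j)\<^sup>2) + 3 * (w j $ j)\<^sup>2))"
    by (intro sum_mono weighted_sum_power2_le)
  also have "\<dots> = (real CARD('p) - 3/4)
      * ((\<Sum>j\<in>UNIV. \<Sum>k\<in>UNIV. (w k $ j)\<^sup>2) + 3 * (\<Sum>j\<in>UNIV. (w j $ j)\<^sup>2))"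
    by (simp add: sum_distrib_left[symmetric] sum.distrib)
  also have "(\<Sum>j\<in>UNIV. \<Sum>k\<in>UNIV. (w k $ j)\<^sup>2) = (\<Sum>k\<in>UNIV. (norm (w k))\<^sup>2)"
    unfolding norm2 by (rule sum.swap)
  also have "(real CARD('p) - 3/4) * ((\<Sum>k\<in>UNIV. (norm (w k))\<^sup>2) + 3 * (\<Sum>j\<in>UNIV. (w j $ j)\<^sup>2))
      \<le> (real CARD('p) - 3/4)
        * ((\<Sum>k\<in>UNIV. (norm (w k))\<^sup>2) + 3 * (\<Sum>j\<in>UNIV. \<delta>\<^sup>2 * (norm (w j))\<^sup>2))"
    using card by (intro mult_left_mono add_left_mono sum_mono diag) linarith+
  also have "\<dots> = (real CARD('p) - 3/4) * (1 + 3 * \<delta>\<^sup>2) * (\<Sum>k\<in>UNIV. (norm (w k))\<^sup>2)"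
    by (simp add: sum_distrib_left[symmetric] algebra_simps)
  finally show ?thesis .
qed

lemma inner_sum_unit_vectors_le:
  fixes u v e :: "'a::real_inner"
  assumes "norm u = norm v" "norm (u - e) \<le> \<delta>" "norm (v + e) \<le> \<delta>"
  shows "\<bar>(u + v) \<bullet> e\<bar> \<le> \<delta> * norm (u + v)"
proof -
  have "(u + v) \<bullet> (u - v) = 0"
    using assms(1) by (simp add: inner_add_left inner_diff_right norm_eq inner_commute[of v u])
  \<comment> \<open>Here 2e = (u - v) + ((v + e) - (u - e)), and the first summand is orthogonal to
    u + v.\<close>
  then have "2 * ((u + v) \<bullet> e) = (u + v) \<bullet> ((v + e) - (u - e))"
    by (simp add: inner_diff_right inner_add_right)
  also have "\<bar>\<dots>\<bar> \<le> norm (u + v) * norm ((v + e) - (u - e))"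
    by (rule Cauchy_Schwarz_ineq2)
  also have "\<dots> \<le> norm (u + v) * (2 * \<delta>)"
    using norm_triangle_ineq4[of "v + e" "u - e"] assms(2,3)
    by (intro mult_left_mono) auto
  finally show ?thesis
    by (simp add: abs_mult mult.commute)
qed

lemma spurious_local_minimum_paired:
  fixes f :: "'p::finite \<times> bool \<Rightarrow> 'n::finite"
  assumes f: "inj f"
  shows "\<exists>A :: real^'n^'n. transpose A = A \<and>
           (\<exists>Y :: real^'p^'n. spurious_local_minimum A Y)"
proof -
  define p where "p = real CARD('p)"
  \<comment> \<open>The divisor p - 1/2 lies strictly between p - 3/4, the limiting constant near
    \<open>Y\<close>, and p, the constant attained when all \<open>w Z k\<close> are equal.\<close>
  define c where "c = 1 / (p - 1/2)"
  \<comment> \<open>With p * \<open>\<epsilon>\<close> = 1/4 the error 3 (p - 3/4)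
    \<open>\<epsilon>\<^sup>2\<close> is at most 3/16, below the gap 1/4 between p - 3/4 and p -
    1/2.\<close>
  define \<epsilon> where "\<epsilon> = 1 / (4 * p)"
  define g :: "'p \<Rightarrow> real^'n" where
    "g k = axis (f (k, True)) 1 + axis (f (k, False)) 1" for k
  define A where "A = (\<Sum>k\<in>UNIV. outer_square (g k)) - c *\<^sub>R outer_square (\<Sum>k\<in>UNIV. g k)"
  \<comment> \<open>Outside the range of \<open>f\<close> the value of \<open>inv f\<close> is
    unspecified, but the row is still a signed unit vector, and \<open>A\<close> vanishes on the
    indices of such rows.\<close>
  define Y :: "real^'p^'n" where
    "Y = (\<chi> i. case inv f i of (k, b) \<Rightarrow> if b then axis k 1 else - axis k 1)"
  define w :: "real^'p^'n \<Rightarrow> 'p \<Rightarrow> real^'p" where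
    "w Z k = Z $ f (k, True) + Z $ f (k, False)" for Z k

  have p: "p \<ge> 1"
    by (simp add: p_def Suc_leI)
  have "transpose A $ i $ j = A $ i $ j" for i j
    by (simp add: A_def transpose_def outer_square_def mult.commute)
  then have symm: "transpose A = A"
    by (simp add: vec_eq_iff)

  have sum_axis: "(\<Sum>i\<in>UNIV. (axis a (1::real) :: real^'n) $ i *\<^sub>R Z $ i) = Z $ a"
    for a and Z :: "real^'p^'n"
  proof -
    have "(\<Sum>i\<in>UNIV. (axis a (1::real) :: real^'n) $ i *\<^sub>R Z $ i)
        = (\<Sum>i\<in>UNIV. if i = a then Z $ i else 0)"
      by (rule sum.cong) (auto simp: axis_def)
    then show ?thesis by simp
  qed
  have w: "(\<Sum>i\<in>UNIV. g k $ i *\<^sub>R Z $ i) = w Z k" for k Z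
    by (simp add: g_def w_def scaleR_add_left sum.distrib sum_axis)
  have wsum: "(\<Sum>i\<in>UNIV. (\<Sum>k\<in>UNIV. g k) $ i *\<^sub>R Z $ i) = (\<Sum>k\<in>UNIV. w Z k)" for Z
    by (simp add: scaleR_sum_left, subst sum.swap, simp add: w)
  have obj: "objective A Z = (\<Sum>k\<in>UNIV. (norm (w Z k))\<^sup>2) - c * (norm (\<Sum>k\<in>UNIV. w Z k))\<^sup>2" for Z
  proof -
    have "objective A Z = (\<Sum>k\<in>UNIV. objective (outer_square (g k)) Z)
        - c * objective (outer_square (\<Sum>k\<in>UNIV. g k)) Z"
      by (simp add: A_def objective_def inner_diff_left inner_sum_left)
    then show ?thesis
      by (simp only: objective_outer_square w wsum)
  qed

  have Yt: "Y $ f (k, True) = axis k 1" and Yf: "Y $ f (k, False) = - axis k 1" for k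
    using f by (simp_all add: Y_def)
  then have objY: "objective A Y = 0"
    by (simp add: obj w_def)
  have Y: "Y \<in> unit_row_matrices"
    by (auto simp: unit_row_matrices_def Y_def norm_axis_1 split: prod.split)

  have loc: "objective A Y \<le> objective A Z"
    if Z: "Z \<in> unit_row_matrices" "norm (Z - Y) < \<epsilon>" for Z
  proof -
    have row: "norm (Z $ i - Y $ i) \<le> \<epsilon>" for i
      using Finite_Cartesian_Product.norm_nth_le[of "Z - Y" i] Z(2) by simp
    have unit: "norm (Z $ i) = 1" for i
      using Z(1) by (auto simp: unit_row_matrices_def power2_eq_1_iff)
        (metis norm_ge_zero not_one_le_zero le_minus_one_simps(3))
    have "\<bar>w Z k $ k\<bar> \<le> \<epsilon> * norm (w Z k)" for k
      using inner_sum_unit_vectors_le[of "Z $ f (k, True)" "Z $ f (k, False)" "axis k 1" \<epsilon>]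
        row[of "f (k, True)"] row[of "f (k, False)"]
      by (simp add: w_def unit Yt Yf inner_axis)
    then have "(norm (\<Sum>k\<in>UNIV. w Z k))\<^sup>2
        \<le> (p - 3/4) * (1 + 3 * \<epsilon>\<^sup>2) * (\<Sum>k\<in>UNIV. (norm (w Z k))\<^sup>2)"
      unfolding p_def by (rule norm_sum_power2_le)
    also have "\<dots> \<le> (p - 1/2) * (\<Sum>k\<in>UNIV. (norm (w Z k))\<^sup>2)"
    proof (rule mult_right_mono)
      \<comment> \<open>Since p is at least 1, p - 3/4 is at most its square p * p, which cancels
        the denominator of \<open>\<epsilon>\<^sup>2\<close>.\<close>
      have "(p - 3/4) * \<epsilon>\<^sup>2 \<le> p\<^sup>2 * \<epsilon>\<^sup>2"
        using p self_le_power[of p 2] by (intro mult_right_mono) auto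
      also have "p\<^sup>2 * \<epsilon>\<^sup>2 = 1/16"
        using p by (simp add: \<epsilon>_def power_divide power_mult_distrib)
      finally show "(p - 3/4) * (1 + 3 * \<epsilon>\<^sup>2) \<le> p - 1/2"
        by (simp add: algebra_simps)
    qed (simp add: sum_nonneg)
    finally show ?thesis
      using p by (simp add: obj[of Z] objY c_def field_simps)
  qed

  obtain u :: "real^'p" where u: "norm u = 1"
    using vector_choose_size[of 1] by auto
  \<comment> \<open>Equal rows make all \<open>w Z k\<close> equal to 2u, the equality case of
    Cauchy-Schwarz; the objective becomes 4p - 4p^2 / (p - 1/2), which is negative.\<close>
  define Z :: "real^'p^'n" where "Z = (\<chi> i. u)"
  have "w Z k = 2 *\<^sub>R u" for k
    by (simp add: w_def Z_def scaleR_2)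
  moreover have "(\<Sum>k\<in>(UNIV :: 'p set). 2 *\<^sub>R u) = (2 * p) *\<^sub>R u"
    by (simp only: sum_constant_scaleR p_def scaleR_scaleR mult.commute)
  ultimately have "objective A Z = 4 * p - c * (2 * p)\<^sup>2"
    by (simp only: obj norm_scaleR u) (simp add: p_def)
  also have "\<dots> < 0"
    using p by (simp add: c_def field_simps power2_eq_square)
  finally have "objective A Z < objective A Y"
    by (simp add: objY)
  moreover have "Z \<in> unit_row_matrices"
    by (simp add: unit_row_matrices_def Z_def u)
  ultimately have "\<not> global_minimum A Y"
    by (auto simp: global_minimum_def not_le)
  moreover have "local_minimum A Y"
    unfolding local_minimum_def using Y loc p by (auto simp: \<epsilon>_def intro!: exI[of _ \<epsilon>])
  ultimately show ?thesis
    using symm by (auto simp: spurious_local_minimum_def)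
qed

theorem theorem1:
  assumes "CARD('n::finite) \<ge> 4"
    and "2 \<le> CARD('p::finite)"
    and "real CARD('p) \<le> real CARD('n) / 2"
  shows "\<exists>A :: real^'n^'n. transpose A = A \<and>
           (\<exists>Y :: real^'p^'n. spurious_local_minimum A Y)"
proof -
  \<comment> \<open>The bound p \<le> n/2 leaves room for p disjoint pairs of rows.\<close>
  have "CARD('p \<times> bool) \<le> CARD('n)"
    using assms(3) by (simp add: card_prod)
  then obtain f :: "'p \<times> bool \<Rightarrow> 'n" where "inj f"
    using card_le_inj[of "UNIV :: ('p \<times> bool) set" "UNIV :: 'n set"] by auto
  then show ?thesis
    by (rule spurious_local_minimum_paired)
qed

end
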